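(* Let $m\ge 2$, $s\ge 1$ and let $X_1,\dots,X_m\in\mathbb{Z}^s$ (not necessarily distinct) span $\mathbb{R}^s$ and satisfy $\langle X_j,\alpha\rangle>0$ for all $j$, for some $\alpha\in\mathbb{R}^s$. Let $\mathcal{J}=X_1\mathbb{N}+\dots+X_m\mathbb{N}$, $\mathcal{L}=X_1\mathbb{Z}+\dots+X_m\mathbb{Z}$ and $\mathbf{C}_X=X_1\mathbb{R}^++\dots+X_m\mathbb{R}^+$. Then the Frobenius set $$\mathcal{F}=\{g\in\mathcal{J}:\ g+\mathbf{C}_X \text{ is a maximal saturated cone}\}$$ is non-empty and finite.
   Context: $\mathbb{N}=\{0,1,2,\dots\}$, $\mathbb{R}^+=[0,\infty)$. For $g\in\mathcal{J}$, the cone $g+\mathbf{C}_X$ is called saturated if $(g+\mathbf{C}_X)\cap\mathcal{J}=(g+\mathbf{C}_X)\cap\mathcal{L}$, i.e. every point of $\mathcal{L}$ in $g+\mathbf{C}_X$ lies in $\mathcal{J}$. A saturated cone $g+\mathbf{C}_X$ is maximal if it is not contained in any other saturated cone $g'+\mathbf{C}_X$ ($g'\in\mathcal{J}$). *)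

theory Defs
  imports "HOL-Analysis.Analysis"
begin

definition nat_gen :: "nat \<Rightarrow> (nat \<Rightarrow> real ^ 's) \<Rightarrow> (real ^ 's) set" where
  "nat_gen m X = {\<Sum>j=1..m. real (n j) *\<^sub>R X j | n :: nat \<Rightarrow> nat. True}"

definition int_gen :: "nat \<Rightarrow> (nat \<Rightarrow> real ^ 's) \<Rightarrow> (real ^ 's) set" where
  "int_gen m X = {\<Sum>j=1..m. real_of_int (k j) *\<^sub>R X j | k :: nat \<Rightarrow> int. True}"

definition cone_gen :: "nat \<Rightarrow> (nat \<Rightarrow> real ^ 's) \<Rightarrow> (real ^ 's) set" where
  "cone_gen m X = {\<Sum>j=1..m. c j *\<^sub>R X j | c :: nat \<Rightarrow> real. \<forall>j\<in>{1..m}. 0 \<le> c j}"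

definition shifted_cone :: "nat \<Rightarrow> (nat \<Rightarrow> real ^ 's) \<Rightarrow> real ^ 's \<Rightarrow> (real ^ 's) set" where
  "shifted_cone m X g = (\<lambda>x. g + x) ` cone_gen m X"

definition saturated_cone :: "nat \<Rightarrow> (nat \<Rightarrow> real ^ 's) \<Rightarrow> real ^ 's \<Rightarrow> bool" where
  "saturated_cone m X g \<longleftrightarrow> g \<in> nat_gen m X \<and>
     shifted_cone m X g \<inter> nat_gen m X = shifted_cone m X g \<inter> int_gen m X"

definition maximal_saturated_cone :: "nat \<Rightarrow> (nat \<Rightarrow> real ^ 's) \<Rightarrow> real ^ 's \<Rightarrow> bool" where
  "maximal_saturated_cone m X g \<longleftrightarrow> saturated_cone m X g \<and>
     \<not> (\<exists>g' \<in> nat_gen m X. saturated_cone m X g' \<and> shifted_cone m X g \<subset> shifted_cone m X g')"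

definition frobenius_set :: "nat \<Rightarrow> (nat \<Rightarrow> real ^ 's) \<Rightarrow> (real ^ 's) set" where
  "frobenius_set m X = {g \<in> nat_gen m X. maximal_saturated_cone m X g}"

end

theory Submission
  imports Defs
begin

text \<open>
  Write every lattice point of the cone as a natural combination of the generators plus one of
  finitely many lattice points of a bounded box. A large multiple of the sum of all generators
  absorbs the negative coefficients of these finitely many remainders, so its cone is saturated.
  By Dickson's lemma every sequence in the semigroup has two terms whose later-minus-earlier
  difference lies in the semigroup again. This makes the pairing with \<open>\<alpha>\<close> well-founded on the
  semigroup, which yields a maximal saturated cone, and it rules out infinitely many pairwise
  incomparable cones.
\<close>

section \<open>Dickson's lemma for sequences\<close>

text \<open>Some subsequence is monotone in one of the two directions; a decreasing one in the
  naturals is eventually constant, so a tail of it is increasing as well.\<close>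

lemma nat_seq_mono_subseq:
  fixes f :: "nat \<Rightarrow> nat"
  obtains r :: "nat \<Rightarrow> nat" where "strict_mono r" "mono (f \<circ> r)"
proof -
  obtain r where r: "strict_mono r" "monoseq (\<lambda>n. f (r n))"
    using seq_monosub by blast
  show thesis
  proof (cases "incseq (\<lambda>n. f (r n))")
    case True
    then show ?thesis using that[of r] r by (simp add: comp_def)
  next
    case False
    then have dec: "decseq (\<lambda>n. f (r n))"
      using r(2) by (simp add: monoseq_iff)
    \<comment> \<open>The decreasing subsequence attains its least value at \<open>N\<close> and
      cannot leave it afterwards.\<close>
    obtain N where N: "\<And>n. f (r N) \<le> f (r n)"
      using ex_has_least_nat[of "\<lambda>_. True" 0 "\<lambda>n. f (r n)"] by auto
    have const: "f (r (N + n)) = f (r N)" for n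
      using N[of "N + n"] decseqD[OF dec, of N "N + n"] by simp
    show ?thesis
    proof (rule that[of "\<lambda>n. r (N + n)"])
      show "strict_mono (\<lambda>n. r (N + n))"
        using r(1) by (simp add: strict_mono_def)
      show "mono (f \<circ> (\<lambda>n. r (N + n)))"
        by (simp add: mono_def const)
    qed
  qed
qed

text \<open>The sequence is thinned once per coordinate; thinning again keeps the monotonicity
  already reached in the earlier coordinates.\<close>

lemma dickson_mono_subseq:
  fixes f :: "nat \<Rightarrow> 'i \<Rightarrow> nat"
  assumes "finite I"
  shows "\<exists>r :: nat \<Rightarrow> nat. strict_mono r \<and> (\<forall>i\<in>I. mono (\<lambda>n. f (r n) i))"
  using assms
proof (induction I)
  case empty
  show ?case using strict_mono_id by auto
next
  case (insert i I)
  then obtain r :: "nat \<Rightarrow> nat" where r: "strict_mono r" "\<forall>j\<in>I. mono (\<lambda>n. f (r n) j)" by blast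
  obtain q :: "nat \<Rightarrow> nat" where q: "strict_mono q" "mono ((\<lambda>n. f (r n) i) \<circ> q)"
    using nat_seq_mono_subseq .
  have "mono (\<lambda>n. f ((r \<circ> q) n) j)" if "j \<in> insert i I" for j
    using that q r by (auto simp: mono_def comp_def strict_mono_less_eq)
  with strict_mono_o[OF r(1) q(1)] show ?case by blast
qed

section \<open>The lattice, the semigroup and the cone\<close>

text \<open>Every coordinate has finitely many possible values. This discreteness later leaves only
  finitely many remainders to absorb.\<close>

lemma finite_bounded_integer_vectors:
  fixes B :: real
  shows "finite {x :: real ^ 'n. \<forall>i. x $ i \<in> \<int> \<and> \<bar>x $ i\<bar> \<le> B}"
proof -
  let ?A = "{k :: real. k \<in> \<int> \<and> \<bar>k\<bar> \<le> B}"
  have "finite (PiE (UNIV :: 'n set) (\<lambda>_. ?A))"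
    by (intro finite_PiE finite_abs_int_segment) simp
  moreover have "{x :: real ^ 'n. \<forall>i. x $ i \<in> \<int> \<and> \<bar>x $ i\<bar> \<le> B}
      \<subseteq> vec_lambda ` PiE (UNIV :: 'n set) (\<lambda>_. ?A)"
  proof
    fix x :: "real ^ 'n"
    assume "x \<in> {x. \<forall>i. x $ i \<in> \<int> \<and> \<bar>x $ i\<bar> \<le> B}"
    then have "($) x \<in> PiE UNIV (\<lambda>_. ?A)" by auto
    moreover have "x = vec_lambda (($) x)" by simp
    ultimately show "x \<in> vec_lambda ` PiE UNIV (\<lambda>_. ?A)" by blast
  qed
  ultimately show ?thesis by (rule finite_surj)
qed

lemma int_gen_integer:
  assumes "\<forall>j\<in>{1..m}. \<forall>i. X j $ i \<in> \<int>" and "x \<in> int_gen m X"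
  shows "x $ i \<in> \<int>"
proof -
  obtain k where "x = (\<Sum>j=1..m. real_of_int (k j) *\<^sub>R X j)"
    using assms(2) by (auto simp: int_gen_def)
  then have "x $ i = (\<Sum>j=1..m. real_of_int (k j) * X j $ i)" by simp
  also have "\<dots> \<in> \<int>"
    using assms(1) by (intro Ints_sum Ints_mult Ints_of_int) blast
  finally show ?thesis .
qed

lemma nat_gen_subset_int_gen: "nat_gen m X \<subseteq> int_gen m X"
proof
  fix x assume "x \<in> nat_gen m X"
  then obtain n where "x = (\<Sum>j=1..m. real (n j) *\<^sub>R X j)"
    by (auto simp: nat_gen_def)
  then have "x = (\<Sum>j=1..m. real_of_int (int (n j)) *\<^sub>R X j)" by simp
  then show "x \<in> int_gen m X" unfolding int_gen_def by (intro CollectI exI[of _ "\<lambda>j. int (n j)"]) simp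
qed

lemma int_gen_diff:
  assumes "x \<in> int_gen m X" "y \<in> int_gen m X"
  shows "x - y \<in> int_gen m X"
proof -
  obtain k l where "x = (\<Sum>j=1..m. real_of_int (k j) *\<^sub>R X j)"
    and "y = (\<Sum>j=1..m. real_of_int (l j) *\<^sub>R X j)"
    using assms by (auto simp: int_gen_def)
  then have "x - y = (\<Sum>j=1..m. real_of_int (k j - l j) *\<^sub>R X j)"
    by (simp add: sum_subtractf scaleR_diff_left)
  then show ?thesis unfolding int_gen_def by (intro CollectI exI[of _ "\<lambda>j. k j - l j"]) simp
qed

lemma nat_gen_subset_cone_gen: "nat_gen m X \<subseteq> cone_gen m X"
proof
  fix x assume "x \<in> nat_gen m X"
  then obtain n where "x = (\<Sum>j=1..m. real (n j) *\<^sub>R X j)"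
    by (auto simp: nat_gen_def)
  then show "x \<in> cone_gen m X"
    unfolding cone_gen_def by (intro CollectI exI[of _ "\<lambda>j. real (n j)"]) simp
qed

lemma cone_gen_zero: "0 \<in> cone_gen m X"
  unfolding cone_gen_def by (intro CollectI exI[of _ "\<lambda>_. 0"]) simp

lemma cone_gen_add:
  assumes "x \<in> cone_gen m X" "y \<in> cone_gen m X"
  shows "x + y \<in> cone_gen m X"
proof -
  obtain c d where "x = (\<Sum>j=1..m. c j *\<^sub>R X j)" "\<forall>j\<in>{1..m}. 0 \<le> c j"
    and "y = (\<Sum>j=1..m. d j *\<^sub>R X j)" "\<forall>j\<in>{1..m}. 0 \<le> d j"
    using assms by (auto simp: cone_gen_def)
  then show ?thesis unfolding cone_gen_def
    by (intro CollectI exI[of _ "\<lambda>j. c j + d j"]) (simp add: sum.distrib scaleR_add_left)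
qed

section \<open>The order on translated cones and on the semigroup\<close>

lemma mem_shifted_cone_iff: "x \<in> shifted_cone m X g \<longleftrightarrow> x - g \<in> cone_gen m X"
proof
  assume "x - g \<in> cone_gen m X"
  then have "g + (x - g) \<in> shifted_cone m X g"
    unfolding shifted_cone_def by (rule imageI)
  then show "x \<in> shifted_cone m X g" by simp
qed (auto simp: shifted_cone_def)

text \<open>The cone contains 0 and is closed under addition, so the apexes alone decide
  inclusion.\<close>

lemma shifted_cone_subset_iff:
  "shifted_cone m X g \<subseteq> shifted_cone m X h \<longleftrightarrow> g - h \<in> cone_gen m X"
proof
  assume "shifted_cone m X g \<subseteq> shifted_cone m X h"
  moreover have "g \<in> shifted_cone m X g"
    by (simp add: mem_shifted_cone_iff cone_gen_zero)
  ultimately have "g \<in> shifted_cone m X h" by blast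
  then show "g - h \<in> cone_gen m X" by (simp add: mem_shifted_cone_iff)
next
  assume gh: "g - h \<in> cone_gen m X"
  show "shifted_cone m X g \<subseteq> shifted_cone m X h"
  proof
    fix x assume "x \<in> shifted_cone m X g"
    then show "x \<in> shifted_cone m X h"
      using cone_gen_add[OF gh, of "x - g"] by (simp add: mem_shifted_cone_iff)
  qed
qed

text \<open>A nonzero combination has a nonzero term, which pairs strictly positively with \<alpha>,
  while no term pairs negatively. Hence the cone is pointed.\<close>

lemma cone_gen_inner_pos:
  assumes pos: "\<forall>j\<in>{1..m}. X j \<bullet> \<alpha> > 0" and "x \<in> cone_gen m X" and "x \<noteq> 0"
  shows "x \<bullet> \<alpha> > 0"
proof -
  obtain c where x: "x = (\<Sum>j=1..m. c j *\<^sub>R X j)" and c: "\<forall>j\<in>{1..m}. 0 \<le> c j"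
    using assms(2) by (auto simp: cone_gen_def)
  obtain i where i: "i \<in> {1..m}" "c i *\<^sub>R X i \<noteq> 0"
    using \<open>x \<noteq> 0\<close> unfolding x by (rule sum.not_neutral_contains_not_neutral)
  have "0 < (\<Sum>j=1..m. c j * (X j \<bullet> \<alpha>))"
  proof (rule sum_pos2)
    show "0 < c i * (X i \<bullet> \<alpha>)"
      using i pos c by (intro mult_pos_pos) (auto simp: order_less_le)
    show "0 \<le> c j * (X j \<bullet> \<alpha>)" if "j \<in> {1..m}" for j
      using that pos c by (simp add: less_imp_le)
  qed (use i in auto)
  then show ?thesis by (simp add: x inner_sum_left)
qed

text \<open>By pointedness, differences in both directions lie in the cone only if the apexes agree,
  so inclusion is antisymmetric on apexes.\<close>

lemma shifted_cone_psubset_iff: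
  assumes pos: "\<forall>j\<in>{1..m}. X j \<bullet> \<alpha> > 0"
  shows "shifted_cone m X g \<subset> shifted_cone m X h \<longleftrightarrow> g - h \<in> cone_gen m X \<and> g \<noteq> h"
proof -
  have "g = h" if "g - h \<in> cone_gen m X" "h - g \<in> cone_gen m X"
  proof (rule ccontr)
    assume "g \<noteq> h"
    then have "(g - h) \<bullet> \<alpha> > 0" "(h - g) \<bullet> \<alpha> > 0"
      using cone_gen_inner_pos[OF pos] that by auto
    then show False by (simp add: inner_diff_left)
  qed
  then show ?thesis
    unfolding psubset_eq set_eq_subset shifted_cone_subset_iff by metis
qed

text \<open>Dickson's lemma is applied to chosen coefficient vectors; the first two terms of the
  monotone subsequence already form the pair.\<close>

lemma nat_gen_sequence_good_pair:
  fixes f :: "nat \<Rightarrow> real ^ 's"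
  assumes "\<And>k. f k \<in> nat_gen m X"
  obtains i j where "i < j" "f j - f i \<in> nat_gen m X"
proof -
  have "\<forall>k. \<exists>n. f k = (\<Sum>j=1..m. real (n j) *\<^sub>R X j)"
    using assms by (auto simp: nat_gen_def)
  then obtain n where n: "\<And>k. f k = (\<Sum>j=1..m. real (n k j) *\<^sub>R X j)"
    by metis
  obtain r :: "nat \<Rightarrow> nat" where r: "strict_mono r" "\<forall>j\<in>{1..m}. mono (\<lambda>k. n (r k) j)"
    using dickson_mono_subseq[of "{1..m}" n] by auto
  have le: "n (r 0) j \<le> n (r 1) j" if "j \<in> {1..m}" for j
    using r(2) that by (auto simp: mono_def)
  have "f (r 1) - f (r 0) = (\<Sum>j=1..m. real (n (r 1) j - n (r 0) j) *\<^sub>R X j)"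
    unfolding n sum_subtractf[symmetric]
    by (intro sum.cong refl) (simp only: of_nat_diff[OF le] scaleR_diff_left)
  then have "f (r 1) - f (r 0) \<in> nat_gen m X"
    unfolding nat_gen_def
    by (intro CollectI exI[of _ "\<lambda>j. n (r 1) j - n (r 0) j"]) simp
  moreover have "r 0 < r 1" using r(1) by (simp add: strict_mono_less)
  ultimately show ?thesis using that by blast
qed

section \<open>Existence of a saturated cone\<close>

lemma cone_lattice_absorbing_shift:
  fixes X :: "nat \<Rightarrow> real ^ 's"
  assumes int: "\<forall>j\<in>{1..m}. \<forall>i. X j $ i \<in> \<int>"
  obtains g where "g \<in> nat_gen m X"
    and "\<And>y. y \<in> int_gen m X \<Longrightarrow> y \<in> cone_gen m X \<Longrightarrow> g + y \<in> nat_gen m X"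
proof -
  \<comment> \<open>\<open>B\<close> bounds the norm of every combination with coefficients in
    [0,1].\<close>
  define B where "B = (\<Sum>j=1..m. norm (X j))"
  define R where "R = {x \<in> int_gen m X. norm x \<le> B}"
  have "R \<subseteq> {x. \<forall>i. x $ i \<in> \<int> \<and> \<bar>x $ i\<bar> \<le> B}"
    using int_gen_integer[OF int] order_trans[OF component_le_norm_cart]
    by (auto simp: R_def)
  then have "finite R"
    using finite_bounded_integer_vectors finite_subset by blast
  have "\<forall>x\<in>R. \<exists>k. x = (\<Sum>j=1..m. real_of_int (k j) *\<^sub>R X j)"
    by (auto simp: R_def int_gen_def)
  then obtain k where k: "\<And>x. x \<in> R \<Longrightarrow> x = (\<Sum>j=1..m. real_of_int (k x j) *\<^sub>R X j)"
    by metis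
  \<comment> \<open>Adding up all absolute values is a crude way to dominate every coefficient of
    every remainder in \<open>R\<close> at once.\<close>
  define N where "N = (\<Sum>x\<in>R. \<Sum>j=1..m. nat \<bar>k x j\<bar>)"
  have N: "0 \<le> int N + k x j" if "x \<in> R" "j \<in> {1..m}" for x j
  proof -
    have "nat \<bar>k x j\<bar> \<le> (\<Sum>j=1..m. nat \<bar>k x j\<bar>)"
      by (rule member_le_sum) (use that in auto)
    also have "\<dots> \<le> N"
      unfolding N_def
      by (rule member_le_sum[of x R "\<lambda>x. \<Sum>j=1..m. nat \<bar>k x j\<bar>"]) (use that \<open>finite R\<close> in auto)
    finally show ?thesis by linarith
  qed
  show thesis
  proof (rule that[of "\<Sum>j=1..m. real N *\<^sub>R X j"])
    show "(\<Sum>j=1..m. real N *\<^sub>R X j) \<in> nat_gen m X"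
      unfolding nat_gen_def by (intro CollectI exI[of _ "\<lambda>_. N"]) simp
  next
    fix y assume y: "y \<in> int_gen m X" "y \<in> cone_gen m X"
    obtain c where c: "y = (\<Sum>j=1..m. c j *\<^sub>R X j)" "\<forall>j\<in>{1..m}. 0 \<le> c j"
      using y(2) by (auto simp: cone_gen_def)
    \<comment> \<open>Rounding the cone coefficients down keeps them non-negative and leaves the
      fractional parts as a remainder of norm at most \<open>B\<close>.\<close>
    define p where "p = (\<Sum>j=1..m. real_of_int \<lfloor>c j\<rfloor> *\<^sub>R X j)"
    have "p \<in> int_gen m X" unfolding p_def int_gen_def by (intro CollectI exI[of _ "\<lambda>j. \<lfloor>c j\<rfloor>"]) simp
    then have "y - p \<in> int_gen m X" using y(1) int_gen_diff by blast
    moreover have "norm (y - p) \<le> B"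
    proof -
      have "y - p = (\<Sum>j=1..m. frac (c j) *\<^sub>R X j)"
        by (simp add: c(1) p_def frac_def sum_subtractf scaleR_diff_left)
      also have "norm \<dots> \<le> B"
        unfolding B_def
      proof (rule sum_norm_le)
        fix j
        have "\<bar>frac (c j)\<bar> \<le> 1" using frac_lt_1[of "c j"] by simp
        then show "norm (frac (c j) *\<^sub>R X j) \<le> norm (X j)"
          by (simp add: mult_left_le_one_le)
      qed
      finally show ?thesis .
    qed
    ultimately have R: "y - p \<in> R" by (simp add: R_def)
    \<comment> \<open>\<open>N\<close> outweighs the possibly negative coefficient of the remainder,
      so \<open>nat\<close> truncates nothing.\<close>
    let ?n = "\<lambda>j. nat (int N + k (y - p) j + \<lfloor>c j\<rfloor>)"
    have n: "real (?n j) = real N + real_of_int (k (y - p) j) + real_of_int \<lfloor>c j\<rfloor>"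
      if "j \<in> {1..m}" for j
    proof -
      have "0 \<le> int N + k (y - p) j + \<lfloor>c j\<rfloor>"
        using N[OF R that] c(2) that by simp
      then show ?thesis by (simp add: of_nat_nat)
    qed
    have "(\<Sum>j=1..m. real N *\<^sub>R X j) + y = (\<Sum>j=1..m. real N *\<^sub>R X j) + (y - p) + p"
      by simp
    also have "\<dots> = (\<Sum>j=1..m. (real N + real_of_int (k (y - p) j) + real_of_int \<lfloor>c j\<rfloor>) *\<^sub>R X j)"
      by (subst k[OF R]) (simp only: p_def sum.distrib scaleR_add_left)
    also have "\<dots> = (\<Sum>j=1..m. real (?n j) *\<^sub>R X j)"
      by (intro sum.cong refl) (simp only: n)
    finally show "(\<Sum>j=1..m. real N *\<^sub>R X j) + y \<in> nat_gen m X"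
      unfolding nat_gen_def by (intro CollectI exI[of _ ?n]) simp
  qed
qed

text \<open>A lattice point of the cone at the absorbing \<open>g\<close> differs from
  \<open>g\<close> by a lattice point of \<open>cone_gen m X\<close>, which \<open>g\<close>
  absorbs.\<close>

lemma saturated_cone_exists:
  fixes X :: "nat \<Rightarrow> real ^ 's"
  assumes "\<forall>j\<in>{1..m}. \<forall>i. X j $ i \<in> \<int>"
  shows "\<exists>g. saturated_cone m X g"
proof -
  obtain g where g: "g \<in> nat_gen m X"
    and abs: "\<And>y. y \<in> int_gen m X \<Longrightarrow> y \<in> cone_gen m X \<Longrightarrow> g + y \<in> nat_gen m X"
    using cone_lattice_absorbing_shift[OF assms] by blast
  have "x \<in> nat_gen m X" if "x \<in> shifted_cone m X g" "x \<in> int_gen m X" for x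
  proof -
    have "x - g \<in> int_gen m X"
      using int_gen_diff that g nat_gen_subset_int_gen by blast
    then show ?thesis
      using abs[of "x - g"] that by (simp add: mem_shifted_cone_iff)
  qed
  then show ?thesis
    using g nat_gen_subset_int_gen unfolding saturated_cone_def by blast
qed

section \<open>Minimal pairings, maximal cones and finiteness\<close>

text \<open>The pairings are real and need not be integers, so descent is stopped by a good pair
  instead: its difference lies in the cone and pairs non-negatively with \<alpha>.\<close>

lemma wf_nat_gen_inner:
  assumes pos: "\<forall>j\<in>{1..m}. X j \<bullet> \<alpha> > 0"
  shows "wf {(x, y). x \<in> nat_gen m X \<and> y \<in> nat_gen m X \<and> x \<bullet> \<alpha> < y \<bullet> \<alpha>}"
  unfolding wf_iff_no_infinite_down_chain
proof
  assume "\<exists>f. \<forall>i. (f (Suc i), f i) \<in> {(x, y). x \<in> nat_gen m X \<and> y \<in> nat_gen m X \<and> x \<bullet> \<alpha> < y \<bullet> \<alpha>}"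
  then obtain f where f: "\<And>i. f i \<in> nat_gen m X" "\<And>i. f (Suc i) \<bullet> \<alpha> < f i \<bullet> \<alpha>"
    by auto
  obtain i j where ij: "i < j" "f j - f i \<in> nat_gen m X"
    using nat_gen_sequence_good_pair[OF f(1)] .
  have "f j \<bullet> \<alpha> < f i \<bullet> \<alpha>"
    \<comment> \<open>Negation turns the descending chain into an increasing one, to which the
      library lemma applies.\<close>
    using lift_Suc_mono_less[of "\<lambda>i. - (f i \<bullet> \<alpha>)", OF _ ij(1)] f(2) by simp
  moreover have "f i \<bullet> \<alpha> \<le> f j \<bullet> \<alpha>"
    using cone_gen_inner_pos[OF pos, of "f j - f i"] subsetD[OF nat_gen_subset_cone_gen ij(2)]
    by (cases "f i = f j") (auto simp: inner_diff_left)
  ultimately show False by simp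
qed

theorem theorem1p1:
  fixes m :: nat and X :: "nat \<Rightarrow> real ^ 's" and \<alpha> :: "real ^ 's"
  assumes "m \<ge> 2"
    and "\<forall>j\<in>{1..m}. \<forall>i. X j $ i \<in> \<int>"
    and "span (X ` {1..m}) = UNIV"
    and "\<forall>j\<in>{1..m}. X j \<bullet> \<alpha> > 0"
  shows "frobenius_set m X \<noteq> {} \<and> finite (frobenius_set m X)"
proof
  note pos = assms(4)
  note psubset = shifted_cone_psubset_iff[OF pos]
  have sat: "g \<in> nat_gen m X" if "saturated_cone m X g" for g
    using that by (simp add: saturated_cone_def)
  \<comment> \<open>Among the saturated apexes, \<open>g\<close> is one with least pairing with
    \<alpha>.\<close>
  obtain g where g: "saturated_cone m X g"
    and min: "\<And>h. saturated_cone m X h \<Longrightarrow> \<not> h \<bullet> \<alpha> < g \<bullet> \<alpha>"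
  proof -
    obtain g0 where "g0 \<in> Collect (saturated_cone m X)"
      using saturated_cone_exists[OF assms(2)] by blast
    then show thesis
      proof (rule wfE_min[OF wf_nat_gen_inner[OF pos]])
      fix z
      assume z: "z \<in> Collect (saturated_cone m X)"
        and min: "\<And>y. (y, z) \<in> {(x, y). x \<in> nat_gen m X \<and> y \<in> nat_gen m X \<and> x \<bullet> \<alpha> < y \<bullet> \<alpha>}
          \<Longrightarrow> y \<notin> Collect (saturated_cone m X)"
      show thesis
        by (rule that[of z]) (use z min sat in auto)
    qed
  qed
  \<comment> \<open>A strictly larger cone has an apex \<open>h\<close> with \<open>g - h\<close>
    nonzero in the cone, hence a smaller pairing, against minimality.\<close>
  have "\<not> shifted_cone m X g \<subset> shifted_cone m X h" if "saturated_cone m X h" for h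
    using min[OF that] cone_gen_inner_pos[OF pos, of "g - h"]
    by (auto simp: psubset inner_diff_left)
  then have "g \<in> frobenius_set m X"
    using g sat by (auto simp: frobenius_set_def maximal_saturated_cone_def)
  then show "frobenius_set m X \<noteq> {}" by blast
  show "finite (frobenius_set m X)"
  proof (rule ccontr)
    assume "infinite (frobenius_set m X)"
    then obtain f :: "nat \<Rightarrow> real ^ 's" where f: "inj f" "range f \<subseteq> frobenius_set m X"
      using infinite_countable_subset by blast
    have F: "f k \<in> nat_gen m X" "maximal_saturated_cone m X (f k)" for k
      using f(2) by (auto simp: frobenius_set_def)
    obtain i j where ij: "i < j" "f j - f i \<in> nat_gen m X"
      using nat_gen_sequence_good_pair[OF F(1)] .
    \<comment> \<open>Injectivity makes the inclusion given by the good pair strict, which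
      contradicts maximality of the cone at \<open>f j\<close>.\<close>
    have "f j \<noteq> f i" using f(1) ij(1) by (auto dest: injD)
    then have "shifted_cone m X (f j) \<subset> shifted_cone m X (f i)"
      using subsetD[OF nat_gen_subset_cone_gen ij(2)] by (simp add: psubset)
    then show False
      using F[of i] F(2)[of j] by (auto simp: maximal_saturated_cone_def)
  qed
qed

end
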